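(* Let $\nu>-\tfrac12$. Then for every $x>0$, $$\mathbf L_\nu(x)=\frac{x^{\nu+1}\,\Gamma(\nu+2)}{\sqrt\pi\,2^{2\nu-\frac12}\,\Gamma\left(\nu+\frac32\right)\Gamma\left(\frac\nu2+\frac34\right)\Gamma\left(\frac\nu2+\frac54\right)}\int_0^1(1-t^2)^{\nu+\frac12}\cosh(xt)\;{}_4F_5\left(\left.\begin{array}{c}\frac12,\ \frac{\nu+3}2,\ \nu+\frac12,\ \nu+1\\ \frac32,\ \frac{\nu+1}2,\ \frac\nu2+\frac34,\ \frac\nu2+\frac54,\ \nu+\frac32\end{array}\right|-\frac{x^2}{16}(1-t^2)^2\right)\mathrm dt .$$
   Context: $\mathbf L_\nu(x)=\sum_{n\ge0}\frac{(x/2)^{2n+\nu+1}}{\Gamma(n+\frac32)\Gamma(n+\nu+\frac32)}$ is the modified Struve function. ${}_4F_5$ is the generalized hypergeometric function $${}_4F_5\left(\left.\begin{array}{c}a_1,a_2,a_3,a_4\\ b_1,b_2,b_3,b_4,b_5\end{array}\right|z\right)=\sum_{n\ge0}\frac{\prod_{j=1}^4(a_j)_n}{\prod_{j=1}^5(b_j)_n}\frac{z^n}{n!},$$ where $(a)_n=\Gamma(a+n)/\Gamma(a)=a(a+1)\cdots(a+n-1)$ is the Pochhammer symbol. *)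

theory Defs
  imports "HOL-Analysis.Analysis"
begin

(* The power is a real power, so this is the modified Struve function for real x > 0
   (and for x = 0 if nu > -1). *)
definition struve_L :: "real \<Rightarrow> real \<Rightarrow> real" where
  "struve_L \<nu> x =
     (\<Sum>n. (x / 2) powr (2 * real n + \<nu> + 1) / (Gamma (real n + 3/2) * Gamma (real n + \<nu> + 3/2)))"

(* Generalized hypergeometric series with upper parameters as and lower parameters bs. *)
definition hypergeo_pFq :: "real list \<Rightarrow> real list \<Rightarrow> real \<Rightarrow> real" where
  "hypergeo_pFq as bs z =
     (\<Sum>n. (\<Prod>a\<leftarrow>as. pochhammer a n) / (\<Prod>b\<leftarrow>bs. pochhammer b n) * (z ^ n / fact n))"

(* Agreement with the library's formal hypergeometric series. *)
lemma hypergeo_pFq_eq_eval_fps: "hypergeo_pFq as bs z = eval_fps (fps_hypergeo as bs 1) z"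
proof -
  have *: "foldl (\<lambda>r c. r * pochhammer c n) r cs = r * (\<Prod>c\<leftarrow>cs. pochhammer c n)"
    for cs :: "real list" and r n
    by (induction cs arbitrary: r) (simp_all add: mult.assoc)
  show ?thesis
    by (simp add: hypergeo_pFq_def eval_fps_def fps_hypergeo_def *)
qed

end

theory Submission
  imports Defs
begin

text \<open>
  Multiply the series of \<open>cosh (x t)\<close> and of the hypergeometric function as a Cauchy product in powers
  of \<open>x\<^sup>2\<close> and integrate term by term, each power giving a Beta integral. With \<open>b = \<nu> + 1\<close>, the
  coefficient of \<open>x ^ (2 N)\<close> becomes a terminating very well-poised \<open>5F4\<close> sum with parameters
  \<open>b, c, b - c, - N\<close> and \<open>c = 1/2\<close>. Since \<open>(k + c) (k + b - c) = k (k + b) + c (b - c)\<close>, that sum is the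
  partial fraction expansion of \<open>1 / (\<Prod>k\<le>N. w + y k)\<close> with nodes \<open>y k = k (k + b)\<close>, evaluated at
  \<open>w = c (b - c)\<close>.
\<close>

section \<open>Partial fractions and the terminating very well-poised sum\<close>

text \<open>Multiplying the expansion over \<open>A\<close> by \<open>inverse (w + y a)\<close> and
  splitting each product of two poles puts the factor \<open>y a - y i\<close> into the old
  residues. What is left is a multiple of \<open>inverse (w + y a)\<close> whose coefficient is the
  expansion over \<open>A\<close> at another value of \<open>w\<close>; hence \<open>w\<close>
  varies in the induction.\<close>

lemma inverse_prod_partial_fractions:
  fixes y :: "'a \<Rightarrow> 'b::field"
  assumes "finite A" "A \<noteq> {}" "inj_on y A" "\<And>i. i \<in> A \<Longrightarrow> w + y i \<noteq> 0"
  shows "inverse (\<Prod>i\<in>A. w + y i) =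
    (\<Sum>i\<in>A. inverse ((w + y i) * (\<Prod>j\<in>A - {i}. y j - y i)))"
  using assms
proof (induction A arbitrary: w rule: finite_ne_induct)
  case (singleton a)
  then show ?case by simp
next
  case (insert a A)
  define P where "P i = (\<Prod>j\<in>A - {i}. y j - y i)" for i
  have ya: "y a - y i \<noteq> 0" if "i \<in> A" for i
    using insert.prems(1) insert.hyps that by (auto simp: inj_on_def)
  then have ya': "y i - y a \<noteq> 0" if "i \<in> A" for i
    using that by fastforce
  have wa: "w + y a \<noteq> 0" and wi: "\<And>i. i \<in> A \<Longrightarrow> w + y i \<noteq> 0"
    using insert.prems(2) by auto
  have inj: "inj_on y A" using insert.prems(1) by (simp add: inj_on_insert)
  have 1: "inverse (\<Prod>i\<in>A. w + y i) = (\<Sum>i\<in>A. inverse ((w + y i) * P i))"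
    unfolding P_def by (rule insert.IH[OF inj wi])
  \<comment> \<open>The residue at the new node is the induction hypothesis at \<open>w = - y a\<close>.\<close>
  have 2: "inverse (\<Prod>i\<in>A. y i - y a) = (\<Sum>i\<in>A. inverse ((y i - y a) * P i))"
    using insert.IH[OF inj, of "- y a"] ya' unfolding P_def by simp
  have 3: "(\<Prod>j\<in>insert a A - {i}. y j - y i) = (y a - y i) * P i" if "i \<in> A" for i
  proof -
    have "insert a A - {i} = insert a (A - {i})" using that insert.hyps by auto
    then show ?thesis using insert.hyps by (simp add: P_def)
  qed
  have "inverse (\<Prod>i\<in>insert a A. w + y i) = (\<Sum>i\<in>A. inverse (w + y a) * inverse ((w + y i) * P i))"
    using insert.hyps by (simp add: 1 sum_distrib_left)
  also have "\<dots> = (\<Sum>i\<in>A. inverse ((w + y i) * ((y a - y i) * P i))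
                     + inverse (w + y a) * inverse ((y i - y a) * P i))"
  proof (rule sum.cong[OF refl])
    fix i assume i: "i \<in> A"
    have "inverse (w + y a) * inverse (w + y i) =
      inverse (w + y i) * inverse (y a - y i) + inverse (w + y a) * inverse (y i - y a)"
    proof -
      have d: "y i - y a = - (y a - y i)" "y a - y i = (w + y a) - (w + y i)" by simp_all
      have "inverse p * inverse q = inverse q * inverse (p - q) - inverse p * inverse (p - q)"
        if "p \<noteq> 0" "q \<noteq> 0" "p - q \<noteq> 0" for p q :: 'b
      proof -
        have "inverse q - inverse p = inverse q * (p - q) * inverse p"
          using that by (simp add: algebra_simps)
        then have "(inverse q - inverse p) * inverse (p - q) = inverse p * inverse q"
          using that(3) by simp
        then show ?thesis by (simp add: left_diff_distrib)
      qed
      from this[OF wa wi[OF i]]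
      have "inverse (w + y a) * inverse (w + y i) =
        inverse (w + y i) * inverse ((w + y a) - (w + y i))
          - inverse (w + y a) * inverse ((w + y a) - (w + y i))"
        using ya[OF i] by simp
      then show ?thesis unfolding d(1) inverse_minus_eq unfolding d(2) by simp
    qed
    then have "(inverse (w + y a) * inverse (w + y i)) * inverse (P i) =
      (inverse (w + y i) * inverse (y a - y i) + inverse (w + y a) * inverse (y i - y a)) * inverse (P i)"
      by (rule arg_cong)
    then show "inverse (w + y a) * inverse ((w + y i) * P i) =
      inverse ((w + y i) * ((y a - y i) * P i)) + inverse (w + y a) * inverse ((y i - y a) * P i)"
      unfolding inverse_mult_distrib unfolding distrib_right by (simp only: mult_ac)
  qed
  also have "\<dots> = (\<Sum>i\<in>A. inverse ((w + y i) * ((y a - y i) * P i)))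
                 + inverse (w + y a) * inverse (\<Prod>i\<in>A. y i - y a)"
    by (simp add: sum.distrib 2 sum_distrib_left)
  also have "\<dots> = (\<Sum>i\<in>insert a A. inverse ((w + y i) * (\<Prod>j\<in>insert a A - {i}. y j - y i)))"
    using insert.hyps 3 by (simp add: add.commute)
  finally show ?case .
qed

text \<open>The factors with \<open>j < k\<close> give \<open>(- 1) ^ k * fact k\<close>, which is
  the base case \<open>N = k\<close>; those with \<open>j > k\<close> then build up
  \<open>fact (N - k)\<close>. These factorials turn the residues into binomial
  coefficients.\<close>

lemma prod_diff_of_nat_atMost:
  fixes k N :: nat
  assumes "k \<le> N"
  shows "(\<Prod>j\<in>{..N} - {k}. of_nat j - of_nat k :: 'a::{comm_ring_1,semiring_char_0}) = (- 1) ^ k * fact k * fact (N - k)"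
  using assms
proof (induction N rule: dec_induct)
  case base
  have "{..k} - {k} = {..<k}" by auto
  moreover have "(\<Prod>j<k. of_nat j - of_nat k :: 'a) = (\<Prod>i<k. - of_nat (Suc i))"
    by (rule prod.reindex_bij_witness[of _ "\<lambda>i. k - Suc i" "\<lambda>i. k - Suc i"]) (auto simp: of_nat_diff)
  moreover have "\<dots> = (- 1) ^ k * fact k"
    by (induction k) (auto simp: algebra_simps)
  ultimately show ?case by simp
next
  case (step N)
  have "{..Suc N} - {k} = insert (Suc N) ({..N} - {k})" using step by auto
  then have "(\<Prod>j\<in>{..Suc N} - {k}. of_nat j - of_nat k :: 'a) =
     (of_nat (Suc N) - of_nat k) * (\<Prod>j\<in>{..N} - {k}. of_nat j - of_nat k)"
    by simp
  also have "\<dots> = of_nat (Suc (N - k)) * ((- 1) ^ k * fact k * fact (N - k))"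
    using step by (simp add: of_nat_diff algebra_simps)
  also have "\<dots> = (- 1) ^ k * fact k * fact (Suc N - k)"
    using step by (simp add: Suc_diff_le algebra_simps)
  finally show ?case .
qed

text \<open>For the nodes \<open>j * (j + b)\<close>, the difference of the nodes at
  \<open>j\<close> and \<open>k\<close> splits as \<open>(j - k) * (b + k + j)\<close>. So a residue
  denominator consists of factorials, which form the signed binomial coefficient, and of a
  Pochhammer symbol with one factor missing. The bounds on \<open>c\<close> keep all poles away from
  \<open>w\<close>.\<close>

lemma well_poised_5F4_sum:
  fixes b c :: real
  assumes "c > 0" "b > c"
  shows "(\<Sum>k\<le>N. (- 1) ^ k * real (N choose k) * (b + 2 * real k) /
             ((k + c) * (k + b - c) * pochhammer (b + k) (Suc N)))
         = fact N / (pochhammer c (Suc N) * pochhammer (b - c) (Suc N))"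
proof -
  define y :: "nat \<Rightarrow> real" where "y j = j * (j + b)" for j
  define w where "w = c * (b - c)"
  have wy: "w + y j = (c + j) * (b - c + j)" for j
    by (simp add: w_def y_def algebra_simps)
  have dy: "y j - y k = (real j - real k) * (b + k + j)" for j k
    by (simp add: y_def algebra_simps)
  have "inj_on y {..N}"
  proof (rule inj_onI)
    fix j k assume "y j = y k"
    then have "(real j - real k) * (b + k + j) = 0" using dy[of j k] by simp
    then show "j = k" using assms by (simp add: add_eq_0_iff)
  qed
  then have "inverse (\<Prod>i\<le>N. w + y i) =
    (\<Sum>i\<le>N. inverse ((w + y i) * (\<Prod>j\<in>{..N} - {i}. y j - y i)))"
    using assms by (intro inverse_prod_partial_fractions) (auto simp: wy add_eq_0_iff)
  also have "(\<Prod>i\<le>N. w + y i) = pochhammer c (Suc N) * pochhammer (b - c) (Suc N)"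
    by (simp add: wy pochhammer_Suc_prod prod.distrib atLeast0AtMost)
  also have "(\<Sum>i\<le>N. inverse ((w + y i) * (\<Prod>j\<in>{..N} - {i}. y j - y i))) =
    (\<Sum>k\<le>N. ((- 1) ^ k * real (N choose k) * (b + 2 * real k) /
             ((k + c) * (k + b - c) * pochhammer (b + k) (Suc N))) / fact N)"
  proof (rule sum.cong[OF refl])
    fix k assume "k \<in> {..N}"
    then have k: "k \<le> N" by simp
    define Q where "Q = (\<Prod>j\<in>{..N} - {k}. b + k + j)"
    define u v B where "u = k + c" and "v = k + b - c" and "B = b + 2 * real k"
    have "Q > 0" unfolding Q_def using assms by (intro prod_pos) auto
    then have nz: "Q \<noteq> 0" "u \<noteq> 0" "v \<noteq> 0" "B \<noteq> 0"
      using assms unfolding u_def v_def B_def by auto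
    \<comment> \<open>The factor \<open>j = k\<close>, absent from \<open>Q\<close>, is
      \<open>b + 2 * k\<close>: this is where the very well-poised numerator comes from.\<close>
    have 1: "pochhammer (b + k) (Suc N) = B * Q"
      unfolding Q_def B_def pochhammer_Suc_prod using k
      by (subst prod.remove[of _ k]) (auto simp: atLeast0AtMost)
    have 2: "(\<Prod>j\<in>{..N} - {k}. y j - y k) = (- 1) ^ k * fact k * fact (N - k) * Q"
      unfolding dy prod.distrib Q_def prod_diff_of_nat_atMost[OF k] ..
    have 3: "w + y k = u * v" by (simp add: wy u_def v_def algebra_simps)
    have 4: "real (N choose k) = fact N / (fact k * fact (N - k))" using k by (rule binomial_fact)
    have "inverse (u * v * ((- 1) ^ k * fact k * fact (N - k) * Q)) =
       (- 1) ^ k * (fact N / (fact k * fact (N - k))) * B / (u * v * (B * Q)) / fact N"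
      using nz by (cases "even k") (simp_all add: field_simps)
    then show "inverse ((w + y k) * (\<Prod>j\<in>{..N} - {k}. y j - y k)) =
       ((- 1) ^ k * real (N choose k) * (b + 2 * real k) /
             ((k + c) * (k + b - c) * pochhammer (b + k) (Suc N))) / fact N"
      unfolding 1 2 3 4 u_def[symmetric] v_def[symmetric] B_def[symmetric] .
  qed
  also have "\<dots> = (\<Sum>k\<le>N. (- 1) ^ k * real (N choose k) * (b + 2 * real k) /
             ((k + c) * (k + b - c) * pochhammer (b + k) (Suc N))) / fact N"
    by (rule sum_divide_distrib[symmetric])
  finally have eq: "inverse (pochhammer c (Suc N) * pochhammer (b - c) (Suc N)) = \<dots>" .
  have "S = fact N / P" if "inverse P = S / fact N" for S P :: real
    using that by (simp add: divide_inverse)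
  from this[OF eq] show ?thesis .
qed

section \<open>Beta integrals in the variable t\<close>

text \<open>Euler's Beta integral under the substitution \<open>u = t^2\<close>, whose derivative
  \<open>2 * t\<close> is the source of the division by 2.\<close>

lemma has_integral_one_minus_square_powr_even_power:
  fixes a :: real
  assumes a: "a > -1"
  shows "((\<lambda>t. (1 - t\<^sup>2) powr a * t ^ (2 * m)) has_integral Beta (real m + 1/2) (a + 1) / 2) {0..1}"
proof -
  define f where "f u = u powr (real m + 1/2 - 1) * (1 - u) powr (a + 1 - 1)" for u :: real
  \<comment> \<open>The open interval excludes \<open>t = 0\<close>, where for \<open>m = 0\<close>
    the substituted integrand is 0 but the target integrand is 1. The endpoints do not affect the
    integral.\<close>
  let ?I = "{0<..<1::real}"
  have int: "(f has_integral Beta (real m + 1/2) (a + 1)) ?I"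
    using has_integral_Beta_real[of "real m + 1/2" "a + 1"] a
    unfolding f_def by (simp add: has_integral_Icc_iff_Ioo)
  \<comment> \<open>The change of variables formula asks for absolute integrability, which comes
    from \<open>f\<close> being nonnegative.\<close>
  have "f absolutely_integrable_on ?I"
    by (rule nonnegative_absolutely_integrable_1) (use int in \<open>auto simp: f_def integrable_on_def\<close>)
  moreover have img: "(\<lambda>t. t\<^sup>2) ` ?I = ?I"
  proof (intro equalityI subsetI)
    fix u assume "u \<in> ?I"
    then have "sqrt u \<in> ?I" "u = (sqrt u)\<^sup>2" by auto
    then show "u \<in> (\<lambda>t. t\<^sup>2) ` ?I" by blast
  qed (auto simp: power_less_one_iff abs_square_less_1)
  moreover have "inj_on (\<lambda>t::real. t\<^sup>2) ?I" by (auto simp: inj_on_def)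
  ultimately have "(\<lambda>t. \<bar>2 * t\<bar> * f (t\<^sup>2)) absolutely_integrable_on ?I \<and>
      integral ?I (\<lambda>t. \<bar>2 * t\<bar> * f (t\<^sup>2)) = Beta (real m + 1/2) (a + 1)"
    using int by (subst has_absolute_integral_change_of_variables_1')
      (auto intro!: derivative_eq_intros)
  then have "((\<lambda>t. \<bar>2 * t\<bar> * f (t\<^sup>2)) has_integral Beta (real m + 1/2) (a + 1)) ?I"
    using has_integral_integral set_lebesgue_integral_eq_integral(1) by metis
  then have "((\<lambda>t. (\<bar>2 * t\<bar> * f (t\<^sup>2)) / 2) has_integral Beta (real m + 1/2) (a + 1) / 2) ?I"
    by (rule has_integral_divide)
  also have "?this \<longleftrightarrow> ((\<lambda>t. (1 - t\<^sup>2) powr a * t ^ (2 * m)) has_integral Beta (real m + 1/2) (a + 1) / 2) ?I"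
  proof (rule has_integral_cong)
    fix t :: real assume t: "t \<in> ?I"
    have "(t\<^sup>2) powr (real m + 1/2 - 1) = t powr (2 * real m - 1)"
      using t by (simp flip: powr_numeral add: powr_powr algebra_simps)
    also have "t * \<dots> = t powr (2 * real m)"
      using t by (simp add: powr_mult_base)
    also have "\<dots> = t ^ (2 * m)" using t by (simp flip: powr_realpow)
    finally show "(\<bar>2 * t\<bar> * f (t\<^sup>2)) / 2 = (1 - t\<^sup>2) powr a * t ^ (2 * m)"
      using t by (simp add: f_def mult_ac)
  qed
  finally show ?thesis by (simp add: has_integral_Icc_iff_Ioo)
qed

section \<open>Pochhammer symbols and Gamma values\<close>

text \<open>\<open>pochhammer a (Suc n)\<close> can lose its first or its last factor. This reduces
  a pair of hypergeometric parameters that differ by one to a linear factor in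
  \<open>n\<close>.\<close>

lemma pochhammer_shift_one:
  fixes a :: "'a::field_char_0"
  assumes "a \<noteq> 0"
  shows "pochhammer (a + 1) n = pochhammer a n * (a + of_nat n) / a"
  using assms pochhammer_rec[of a n] by (simp add: pochhammer_Suc field_simps)

lemma Gamma_plus_of_nat_real:
  fixes z :: real
  assumes "z > 0"
  shows "Gamma (z + real n) = pochhammer z n * Gamma z"
proof -
  have "z \<notin> \<int>\<^sub>\<le>\<^sub>0" using assms by (auto elim!: nonpos_Ints_cases)
  with Gamma_real_pos[OF assms] show ?thesis by (simp add: pochhammer_Gamma)
qed

lemma Gamma_legendre_duplication_real:
  fixes z :: real
  assumes "z > 0"
  shows "Gamma z * Gamma (z + 1/2) = 2 powr (1 - 2 * z) * sqrt pi * Gamma (2 * z)"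
proof -
  have "complex_of_real z \<notin> \<int>\<^sub>\<le>\<^sub>0" "complex_of_real z + 1/2 \<notin> \<int>\<^sub>\<le>\<^sub>0"
    using assms by (auto elim!: nonpos_Ints_cases simp: complex_eq_iff)
  moreover have e: "exp ((1 - 2 * complex_of_real z) * of_real (ln 2)) = of_real (2 powr (1 - 2 * z))"
    by (simp add: powr_def flip: exp_of_real)
  ultimately
  have "complex_of_real (Gamma z * Gamma (z + 1/2)) = complex_of_real (2 powr (1 - 2 * z) * sqrt pi * Gamma (2 * z))"
    using Gamma_legendre_duplication[of "complex_of_real z"] by (simp flip: Gamma_complex_of_real)
  then show ?thesis by (simp only: of_real_eq_iff)
qed

section \<open>The even cosh series and termwise integration\<close>

text \<open>Without the vanishing odd terms, the index matches that of the hypergeometric series in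
  the Cauchy product.\<close>

lemma cosh_sums_even: "(\<lambda>n. x ^ (2 * n) / fact (2 * n)) sums cosh (x::real)"
proof -
  have "(\<lambda>n. (\<lambda>n. if even n then x ^ n /\<^sub>R fact n else 0) (2 * n)) sums cosh x"
    by (subst sums_mono_reindex) (auto simp: strict_mono_def cosh_converges elim!: evenE)
  then show ?thesis by (simp add: divide_inverse mult.commute)
qed

text \<open>The Weierstrass M-test gives uniform convergence of the partial sums, and a uniform
  limit of continuous functions on a compact interval may be exchanged with the integral.\<close>

lemma integral_series_uniform:
  fixes f :: "nat \<Rightarrow> real \<Rightarrow> real"
  assumes "\<And>n. continuous_on {a..b} (f n)"
    and "\<And>n t. t \<in> {a..b} \<Longrightarrow> \<bar>f n t\<bar> \<le> M n" and "summable M"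
  shows "(\<lambda>n. integral {a..b} (f n)) sums integral {a..b} (\<lambda>t. \<Sum>n. f n t)"
proof -
  have "uniform_limit {a..b} (\<lambda>n t. \<Sum>i<n. f i t) (\<lambda>t. \<Sum>i. f i t) sequentially"
    using assms(2,3) by (intro Weierstrass_m_test) auto
  moreover have "continuous_on {a..b} (\<lambda>t. \<Sum>i<n. f i t)" for n
    by (intro continuous_intros assms)
  ultimately obtain I J where IJ: "\<And>n. ((\<lambda>t. \<Sum>i<n. f i t) has_integral I n) {a..b}"
    "((\<lambda>t. \<Sum>i. f i t) has_integral J) {a..b}" "I \<longlonglongrightarrow> J"
    using uniform_limit_integral[OF _ _ sequentially_bot] by metis
  have "I n = (\<Sum>i<n. integral {a..b} (f i))" for n
    using IJ(1)[of n] assms(1)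
    by (subst integral_sum[symmetric]) (auto intro: integrable_continuous_real dest: integral_unique)
  then have "I = (\<lambda>n. \<Sum>i<n. integral {a..b} (f i))" ..
  with IJ show ?thesis by (simp add: sums_def integral_unique)
qed

section \<open>Coefficients of the 4F5 series: closed form and growth\<close>

definition hyp_coeff :: "real \<Rightarrow> nat \<Rightarrow> real" where
  "hyp_coeff \<nu> n =
     (\<Prod>a\<leftarrow>[1/2, (\<nu> + 3)/2, \<nu> + 1/2, \<nu> + 1]. pochhammer a n) /
     (\<Prod>b\<leftarrow>[3/2, (\<nu> + 1)/2, \<nu>/2 + 3/4, \<nu>/2 + 5/4, \<nu> + 3/2]. pochhammer b n) / fact n"

text \<open>Three upper parameters pair with lower ones at distance one and leave linear factors.
  The lower pair \<open>\<nu>/2 + 3/4\<close>, \<open>\<nu>/2 + 5/4\<close> merges by the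
  duplication formula, which produces \<open>4 ^ n\<close>.\<close>

lemma hyp_coeff_eq:
  assumes "\<nu> > - 1/2"
  shows "hyp_coeff \<nu> n = pochhammer (\<nu> + 1) n * (\<nu> + 1 + 2 * real n) * (\<nu> + 1/2) * 4 ^ n /
     ((2 * real n + 1) * (\<nu> + 1) * (\<nu> + 1/2 + n) * fact n * pochhammer (\<nu> + 3/2) (2 * n))"
proof -
  have p: "pochhammer a n > 0" if "a > 0" for a :: real
    using that by (rule pochhammer_pos)
  have 1: "pochhammer (3/2) n = pochhammer (1/2) n * (2 * real n + 1)"
    using pochhammer_shift_one[of "1/2 :: real" n] by (simp add: field_simps)
  have 2: "pochhammer ((\<nu> + 3)/2) n = pochhammer ((\<nu> + 1)/2) n * (\<nu> + 1 + 2 * real n) / (\<nu> + 1)"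
    using pochhammer_shift_one[of "(\<nu> + 1)/2" n] assms by (simp add: field_simps)
  have 3: "pochhammer (\<nu> + 3/2) n = pochhammer (\<nu> + 1/2) n * (\<nu> + 1/2 + n) / (\<nu> + 1/2)"
    using pochhammer_shift_one[of "\<nu> + 1/2" n] assms by (simp add: add.assoc)
  have 4: "pochhammer (\<nu>/2 + 3/4) n * pochhammer (\<nu>/2 + 5/4) n = pochhammer (\<nu> + 3/2) (2 * n) / 4 ^ n"
  proof -
    have "2 * (\<nu>/2 + 3/4) = \<nu> + 3/2" "\<nu>/2 + 3/4 + 1/2 = \<nu>/2 + 5/4" by simp_all
    then show ?thesis
      using pochhammer_double[of "\<nu>/2 + 3/4" n] by (simp add: power_mult add_ac)
  qed
  have nz: "pochhammer (1/2) n \<noteq> (0::real)" "pochhammer ((\<nu> + 1)/2) n \<noteq> 0" "pochhammer (\<nu> + 1/2) n \<noteq> 0"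
    "pochhammer (\<nu> + 3/2) (2 * n) \<noteq> 0" "\<nu> + 1 \<noteq> 0" "\<nu> + 1/2 \<noteq> 0" "\<nu> + 1/2 + n \<noteq> 0" "2 * real n + 1 \<noteq> 0"
    using p[of "1/2"] p[of "(\<nu> + 1)/2"] p[of "\<nu> + 1/2"] pochhammer_pos[of "\<nu> + 3/2" "2 * n"] assms by auto
  have "hyp_coeff \<nu> n = pochhammer (1/2) n * pochhammer ((\<nu> + 3)/2) n * pochhammer (\<nu> + 1/2) n * pochhammer (\<nu> + 1) n /
    (pochhammer (3/2) n * pochhammer ((\<nu> + 1)/2) n * (pochhammer (\<nu>/2 + 3/4) n * pochhammer (\<nu>/2 + 5/4) n) * pochhammer (\<nu> + 3/2) n) / fact n"
    by (simp add: hyp_coeff_def mult.assoc)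
  also have "\<dots> = pochhammer (\<nu> + 1) n * (\<nu> + 1 + 2 * real n) * (\<nu> + 1/2) * 4 ^ n /
     ((2 * real n + 1) * (\<nu> + 1) * (\<nu> + 1/2 + n) * fact n * pochhammer (\<nu> + 3/2) (2 * n))"
    unfolding 1 2 3 4 using nz by (simp add: divide_simps)
  finally show ?thesis .
qed

text \<open>In the closed form the quotient of Pochhammer symbols is at most 1 and the linear
  factors contribute at most 2. The resulting majorant of the series is
  \<open>2 * exp (4 * \<bar>z\<bar>)\<close>, so it converges absolutely for every
  \<open>z\<close>.\<close>

lemma hyp_coeff_bounds:
  assumes "\<nu> > - 1/2"
  shows "0 \<le> hyp_coeff \<nu> n" "hyp_coeff \<nu> n \<le> 2 * 4 ^ n / fact n"
proof -
  define P where "P = pochhammer (\<nu> + 1) n"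
  define Q where "Q = pochhammer (\<nu> + 3/2) (2 * n)"
  have P: "P > 0" unfolding P_def using assms by (intro pochhammer_pos) auto
  have "P \<le> pochhammer (\<nu> + 3/2) n * 1"
    unfolding P_def pochhammer_prod using assms by (auto intro!: prod_mono)
  \<comment> \<open>The additional \<open>n\<close> factors all exceed 1, because
    \<open>\<nu> + 3/2 > 1\<close>.\<close>
  also have "\<dots> \<le> pochhammer (\<nu> + 3/2) n * pochhammer (\<nu> + 3/2 + n) n"
    using assms unfolding pochhammer_prod[of "\<nu> + 3/2 + n"]
    by (intro mult_left_mono prod_ge_1 pochhammer_nonneg) auto
  also have "\<dots> = Q" unfolding Q_def mult_2 by (rule pochhammer_product'[symmetric])
  finally have PQ: "P \<le> Q" .
  have nu: "\<nu> + 1/2 > 0" "\<nu> + 1 > 0" using assms by auto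
  have eq: "hyp_coeff \<nu> n = (P / Q) * ((\<nu> + 1 + 2 * real n) / ((2 * real n + 1) * (\<nu> + 1))) * ((\<nu> + 1/2) / (\<nu> + 1/2 + n)) * (4 ^ n / fact n)"
    by (simp add: hyp_coeff_eq[OF assms] P_def Q_def)
  show "0 \<le> hyp_coeff \<nu> n"
    unfolding eq using P PQ nu by (intro mult_nonneg_nonneg divide_nonneg_nonneg) auto
  have "\<nu> + 1 + 2 * real n \<le> 2 * ((2 * real n + 1) * (\<nu> + 1))"
  proof -
    \<comment> \<open>This is exactly the right side minus the left side of the claim.\<close>
    have "0 \<le> \<nu> + 1 + 2 * real n * (2 * \<nu> + 1)" using assms by simp
    then show ?thesis by (simp add: algebra_simps)
  qed
  then have r: "(\<nu> + 1 + 2 * real n) / ((2 * real n + 1) * (\<nu> + 1)) \<le> 2"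
    using nu by (simp add: pos_divide_le_eq)
  have "(P / Q) * ((\<nu> + 1 + 2 * real n) / ((2 * real n + 1) * (\<nu> + 1))) * ((\<nu> + 1/2) / (\<nu> + 1/2 + n)) * (4 ^ n / fact n)
     \<le> 1 * 2 * 1 * (4 ^ n / fact n)"
    using P PQ nu r
    by (intro mult_mono mult_nonneg_nonneg divide_nonneg_nonneg) auto
  then show "hyp_coeff \<nu> n \<le> 2 * 4 ^ n / fact n" unfolding eq by simp
qed

lemma summable_hyp_coeff:
  assumes "\<nu> > - 1/2"
  shows "summable (\<lambda>n. norm (hyp_coeff \<nu> n * z ^ n))"
proof (rule summable_comparison_test')
  show "summable (\<lambda>n. 2 * ((4 * \<bar>z\<bar>) ^ n / fact n))"
    using summable_exp[of "4 * \<bar>z\<bar>"] by (intro summable_mult) (simp add: divide_inverse mult.commute)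
  fix n
  have "norm (hyp_coeff \<nu> n * z ^ n) = hyp_coeff \<nu> n * \<bar>z\<bar> ^ n"
    using hyp_coeff_bounds[OF assms] by (simp add: abs_mult power_abs)
  also have "\<dots> \<le> 2 * 4 ^ n / fact n * \<bar>z\<bar> ^ n"
    by (intro mult_right_mono hyp_coeff_bounds assms) auto
  finally show "norm (norm (hyp_coeff \<nu> n * z ^ n)) \<le> 2 * ((4 * \<bar>z\<bar>) ^ n / fact n)"
    by (simp add: power_mult_distrib)
qed

lemma hypergeo_pFq_eq_hyp_coeff:
  "hypergeo_pFq [1/2, (\<nu> + 3)/2, \<nu> + 1/2, \<nu> + 1]
     [3/2, (\<nu> + 1)/2, \<nu>/2 + 3/4, \<nu>/2 + 5/4, \<nu> + 3/2] z = (\<Sum>n. hyp_coeff \<nu> n * z ^ n)"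
  unfolding hypergeo_pFq_def hyp_coeff_def by simp

section \<open>The coefficient of each power of x\<close>

text \<open>The case \<open>s = 0\<close> occurs for \<open>s = 1 - t^2\<close> at
  \<open>t = 1\<close>; there both sides vanish since \<open>0 powr a = 0\<close> for every
  \<open>a\<close>.\<close>

lemma powr_mult_power: "(s::real) \<ge> 0 \<Longrightarrow> s powr a * s ^ n = s powr (a + n)"
  by (cases "s = 0") (simp_all add: powr_add powr_realpow)

text \<open>The left side is what termwise integration yields for \<open>x ^ (2 * N)\<close>, the
  right side is the Struve coefficient. Up to a factor free of \<open>k\<close>, each summand is
  that of \<open>well_poised_5F4_sum\<close> with \<open>c = 1/2\<close>.\<close>

lemma struve_L_coefficient:
  fixes \<nu> :: real
  assumes "\<nu> > - 1/2"
  shows "Gamma (\<nu> + 2) /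
      (sqrt pi * 2 powr (2 * \<nu> - 1/2) * Gamma (\<nu> + 3/2) * Gamma (\<nu>/2 + 3/4) * Gamma (\<nu>/2 + 5/4)) *
    (\<Sum>k\<le>N. hyp_coeff \<nu> k * (- 1/16) ^ k / fact (2 * (N - k)) *
       (Beta (real (N - k) + 1/2) (\<nu> + 1/2 + real (2 * k) + 1) / 2))
    = (1/2) powr (2 * real N + \<nu> + 1) / (Gamma (real N + 3/2) * Gamma (real N + \<nu> + 3/2))"
proof -
  define b where "b = \<nu> + 1"
  have b: "b > 1/2" using assms by (simp add: b_def)
  define G where "G = Gamma (\<nu> + 3/2)"
  define C where "C = Gamma (\<nu> + 2) /
      (sqrt pi * 2 powr (2 * \<nu> - 1/2) * Gamma (\<nu> + 3/2) * Gamma (\<nu>/2 + 3/4) * Gamma (\<nu>/2 + 5/4))"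
  \<comment> \<open>\<open>K\<close> collects everything in \<open>C\<close> times a summand that
    does not depend on \<open>k\<close>.\<close>
  define K where "K = 2 powr (1 - \<nu>) * (\<nu> + 1/2) * (1/4) ^ N / (4 * sqrt pi * G * fact N)"
  have G: "G > 0" unfolding G_def using assms by (intro Gamma_real_pos) auto
  have "Gamma (\<nu>/2 + 3/4) * Gamma (\<nu>/2 + 5/4) = 2 powr (- \<nu> - 1/2) * sqrt pi * G"
  proof -
    have "2 * (\<nu>/2 + 3/4) = \<nu> + 3/2" "\<nu>/2 + 3/4 + 1/2 = \<nu>/2 + 5/4" by simp_all
    then show ?thesis
      using Gamma_legendre_duplication_real[of "\<nu>/2 + 3/4"] assms by (simp add: G_def add.commute)
  qed
  then have "C = Gamma (\<nu> + 2) / (sqrt pi * 2 powr (2 * \<nu> - 1/2) * G * (2 powr (- \<nu> - 1/2) * sqrt pi * G))"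
    unfolding C_def G_def[symmetric] by (simp only: mult.assoc)
  also have "\<dots> = Gamma (\<nu> + 2) / ((2 powr (2 * \<nu> - 1/2) * 2 powr (- \<nu> - 1/2)) * (sqrt pi * sqrt pi) * G\<^sup>2)"
    by (simp add: power2_eq_square mult_ac)
  also have "2 powr (2 * \<nu> - 1/2) * 2 powr (- \<nu> - 1/2) = 1 / (2 powr (1 - \<nu>) :: real)"
    by (simp flip: powr_add powr_minus_divide)
  also have "sqrt pi * sqrt pi = pi" by simp
  also have "Gamma (\<nu> + 2) = b * Gamma b"
    using Gamma_plus_of_nat_real[of b 1] b by (simp add: b_def add_ac)
  finally have C: "C = b * Gamma b * 2 powr (1 - \<nu>) / (pi * G\<^sup>2)" by simp

  have summand: "C * (hyp_coeff \<nu> k * (- 1/16) ^ k / fact (2 * (N - k)) *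
       (Beta (real (N - k) + 1/2) (\<nu> + 1/2 + real (2 * k) + 1) / 2)) =
     K * ((- 1) ^ k * real (N choose k) * (b + 2 * real k) /
             ((k + 1/2) * (k + b - 1/2) * pochhammer (b + k) (Suc N)))" if kN: "k \<le> N" for k
  proof -
    obtain m where N: "N = k + m" using le_Suc_ex[OF kN] by blast
    define p where "p = pochhammer (\<nu> + 3/2) (2 * k)"
    have p: "p > 0" unfolding p_def using assms by (intro pochhammer_pos) auto
    have Gp: "Gamma (\<nu> + 1/2 + real (2 * k) + 1) = p * G"
    proof -
      have "\<nu> + 1/2 + real (2 * k) + 1 = \<nu> + 3/2 + real (2 * k)" by simp
      then show ?thesis
        using Gamma_plus_of_nat_real[of "\<nu> + 3/2" "2 * k"] assms by (simp add: p_def G_def add_ac)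
    qed
    \<comment> \<open>Here \<open>fact (2 * m)\<close> cancels the denominator of the cosh
      coefficient, and \<open>4 ^ m\<close> later joins \<open>4 ^ k\<close> to form
      \<open>4 ^ N\<close>.\<close>
    have Gm: "Gamma (real m + 1/2) = sqrt pi * fact (2 * m) / (4 ^ m * fact m)"
    proof -
      have "Gamma (real m + 1/2) = pochhammer (1/2) m * sqrt pi"
        using Gamma_plus_of_nat_real[of "1/2" m] by (simp add: Gamma_one_half_real add.commute)
      moreover have "pochhammer (1/2) m = (fact (2 * m) / (4 ^ m * fact m) :: real)"
        using fact_double[of m, where 'a = real] by (simp add: power_mult)
      ultimately show ?thesis by simp
    qed
    have Gb: "pochhammer b k * Gamma b = Gamma (b + k)"
      using Gamma_plus_of_nat_real[of b k] b by simp
    define q where "q = pochhammer (b + k) (Suc N)"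
    have q: "q > 0" unfolding q_def using b by (intro pochhammer_pos) auto
    \<comment> \<open>The two Beta arguments add up to \<open>b + k + N + 1\<close>. The split
      leaves the Pochhammer symbol of the well-poised sum, and \<open>Gamma (b + k)\<close> cancels
      by \<open>Gb\<close>.\<close>
    have Gq: "Gamma (real m + 1/2 + (\<nu> + 1/2 + real (2 * k) + 1)) = q * Gamma (b + k)"
    proof -
      have "real m + 1/2 + (\<nu> + 1/2 + real (2 * k) + 1) = b + k + real (Suc N)"
        by (simp add: N b_def)
      moreover have "b + k > 0" using b by simp
      ultimately show ?thesis using Gamma_plus_of_nat_real by (simp only: q_def)
    qed
    have Gb0: "Gamma (b + k) > 0" using b by (intro Gamma_real_pos) auto
    have hc: "hyp_coeff \<nu> k = pochhammer b k * (b + 2 * real k) * (\<nu> + 1/2) * 4 ^ k /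
     ((2 * real k + 1) * b * (\<nu> + 1/2 + k) * fact k * p)"
      using hyp_coeff_eq[OF assms, of k] by (simp add: b_def p_def)
    have kb: "real k + b - 1/2 = \<nu> + 1/2 + k" by (simp add: b_def)
    have bin: "real (N choose k) = fact N / (fact k * fact m)" using binomial_fact[OF kN] by (simp add: N)
    have "C * (hyp_coeff \<nu> k * (- 1/16) ^ k / fact (2 * (N - k)) *
       (Beta (real (N - k) + 1/2) (\<nu> + 1/2 + real (2 * k) + 1) / 2)) =
      (pochhammer b k * Gamma b) * b * 2 powr (1 - \<nu>) / (pi * G\<^sup>2) *
      ((b + 2 * real k) * (\<nu> + 1/2) * 4 ^ k /
      ((2 * real k + 1) * b * (\<nu> + 1/2 + k) * fact k * p) * (- 1/16) ^ k / fact (2 * m) *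
       (sqrt pi * fact (2 * m) / (4 ^ m * fact m) * (p * G) / (q * Gamma (b + k)) / 2))"
      unfolding C hc Beta_def Gq[symmetric] Gp[symmetric] Gm[symmetric] by (simp add: N mult_ac)
    also have "\<dots> = 2 powr (1 - \<nu>) / (pi * G) *
      ((b + 2 * real k) * (\<nu> + 1/2) * (4 ^ k * (- 1/16) ^ k) /
      ((2 * real k + 1) * (\<nu> + 1/2 + k) * fact k) *
       (sqrt pi / (4 ^ m * fact m) / q / 2))"
      unfolding Gb using b p q G Gb0 less_imp_neq[OF Gb0] by (simp add: power2_eq_square mult_ac)
    also have "4 ^ k * (- 1/16) ^ k = (- 1 :: real) ^ k / 4 ^ k"
      by (simp flip: power_mult_distrib power_divide)
    also have "2 powr (1 - \<nu>) / (pi * G) *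
      ((b + 2 * real k) * (\<nu> + 1/2) * ((- 1) ^ k / 4 ^ k) /
      ((2 * real k + 1) * (\<nu> + 1/2 + k) * fact k) *
       (sqrt pi / (4 ^ m * fact m) / q / 2)) =
      2 powr (1 - \<nu>) / (sqrt pi * G) *
      ((b + 2 * real k) * (\<nu> + 1/2) * ((- 1) ^ k / 4 ^ k) /
      ((2 * real k + 1) * (\<nu> + 1/2 + k) * fact k) *
       (1 / (4 ^ m * fact m) / q / 2))"
    proof -
      have "X / (pi * G) * (Y * (r / Z / q / 2)) = X / (r * G) * (Y * (1 / Z / q / 2))"
        if "r * r = pi" "r \<noteq> 0" for r X Y Z
        unfolding that(1)[symmetric] using that(2) by simp
      from this[of "sqrt pi"] have "X / (pi * G) * (Y * (sqrt pi / Z / q / 2)) =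
          X / (sqrt pi * G) * (Y * (1 / Z / q / 2))" for X Y Z
        by simp
      then show ?thesis .
    qed
    also have "\<dots> = K * ((- 1) ^ k * real (N choose k) * (b + 2 * real k) /
             ((k + 1/2) * (k + b - 1/2) * q))"
    proof -
      \<comment> \<open>The factor \<open>2 * k + 1\<close> left by the parameters 1/2 and 3/2 is
        \<open>2 * (k + c)\<close> at \<open>c = 1/2\<close>.\<close>
      define u where "u = real k + 1/2"
      have u: "2 * real k + 1 = 2 * u" "u > 0" by (simp_all add: u_def)
      show ?thesis
        unfolding K_def kb bin u(1) u_def[symmetric] using b q G u(2)
        by (simp add: N power_add power_divide mult_ac)
    qed
    finally show ?thesis unfolding q_def .
  qed
  have "C * (\<Sum>k\<le>N. hyp_coeff \<nu> k * (- 1/16) ^ k / fact (2 * (N - k)) *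
       (Beta (real (N - k) + 1/2) (\<nu> + 1/2 + real (2 * k) + 1) / 2)) =
     K * (\<Sum>k\<le>N. (- 1) ^ k * real (N choose k) * (b + 2 * real k) /
             ((k + 1/2) * (k + b - 1/2) * pochhammer (b + k) (Suc N)))"
    unfolding sum_distrib_left by (rule sum.cong[OF refl]) (simp only: summand atMost_iff)
  also have "\<dots> = K * (fact N / (pochhammer (1/2) (Suc N) * pochhammer (b - 1/2) (Suc N)))"
    using well_poised_5F4_sum[of "1/2" b N] b by simp
  also have "pochhammer (1/2) (Suc N) = Gamma (real N + 3/2) / sqrt pi"
    using Gamma_plus_of_nat_real[of "1/2" "Suc N"] by (simp add: Gamma_one_half_real add.commute)
  also have "pochhammer (b - 1/2) (Suc N) = Gamma (real N + \<nu> + 3/2) / Gamma (\<nu> + 1/2)"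
  proof -
    have "\<nu> + 1/2 > 0" using assms by simp
    from Gamma_plus_of_nat_real[OF this, of "Suc N"] Gamma_real_pos[OF this] show ?thesis
      by (simp add: b_def add_ac)
  qed
  also have "K * (fact N / (Gamma (real N + 3/2) / sqrt pi * (Gamma (real N + \<nu> + 3/2) / Gamma (\<nu> + 1/2)))) =
     2 powr (1 - \<nu>) * (1/4) ^ N / 4 / (Gamma (real N + 3/2) * Gamma (real N + \<nu> + 3/2))"
  proof -
    \<comment> \<open>The factor \<open>\<nu> + 1/2\<close> of \<open>K\<close> and the Gamma value
      at \<open>\<nu> + 1/2\<close> cancel \<open>G\<close>.\<close>
    have "G = (\<nu> + 1/2) * Gamma (\<nu> + 1/2)"
      using Gamma_plus_of_nat_real[of "\<nu> + 1/2" 1] assms by (simp add: G_def add_ac)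
    moreover have "\<nu> + 1/2 \<noteq> 0" "Gamma (\<nu> + 1/2) > 0" using assms by auto
    ultimately show ?thesis by (simp add: K_def)
  qed
  also have "2 powr (1 - \<nu>) * (1/4) ^ N / 4 = (1/2) powr (2 * real N + \<nu> + 1)"
  proof -
    have "2 powr (2 * real N) = (4 :: real) ^ N"
      using powr_realpow[of 2 "2 * N"] by (simp add: power_mult)
    then show ?thesis
      by (simp add: powr_divide powr_add powr_diff power_divide)
  qed
  finally show ?thesis unfolding C_def .
qed

section \<open>Termwise integration and comparison with the Struve series\<close>

theorem theorem5:
  fixes \<nu> x :: real
  assumes "\<nu> > - 1/2" and "x > 0"
  shows "struve_L \<nu> x =
    x powr (\<nu> + 1) * Gamma (\<nu> + 2) /
      (sqrt pi * 2 powr (2 * \<nu> - 1/2) * Gamma (\<nu> + 3/2) * Gamma (\<nu>/2 + 3/4) * Gamma (\<nu>/2 + 5/4)) *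
    integral {0..1} (\<lambda>t. (1 - t\<^sup>2) powr (\<nu> + 1/2) * cosh (x * t) *
      hypergeo_pFq [1/2, (\<nu> + 3)/2, \<nu> + 1/2, \<nu> + 1]
                   [3/2, (\<nu> + 1)/2, \<nu>/2 + 3/4, \<nu>/2 + 5/4, \<nu> + 3/2]
                   (- (x\<^sup>2 / 16) * (1 - t\<^sup>2)\<^sup>2))"
proof -
  define C where "C = Gamma (\<nu> + 2) /
      (sqrt pi * 2 powr (2 * \<nu> - 1/2) * Gamma (\<nu> + 3/2) * Gamma (\<nu>/2 + 3/4) * Gamma (\<nu>/2 + 5/4))"
  define z where "z t = - (x\<^sup>2 / 16) * (1 - t\<^sup>2)\<^sup>2" for t
  define g where "g t n = hyp_coeff \<nu> n * z t ^ n" for t n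
  define h where "h t n = (x * t) ^ (2 * n) / fact (2 * n)" for t n
  \<comment> \<open>The part of the integrand that is homogeneous of degree \<open>2 * N\<close> in
    \<open>x\<close>.\<close>
  define f where "f N t = (1 - t\<^sup>2) powr (\<nu> + 1/2) * (\<Sum>k\<le>N. g t k * h t (N - k))" for N t
  \<comment> \<open>A majorant free of \<open>t\<close>: on the unit interval the hypergeometric
    argument is at most \<open>x^2 / 16\<close> in absolute value, and \<open>x * t\<close> is at
    most \<open>x\<close>. It is summable as a Cauchy product of absolutely convergent
    series.\<close>
  define M where "M N = (\<Sum>k\<le>N. norm (hyp_coeff \<nu> k * (x\<^sup>2 / 16) ^ k) * norm (x ^ (2 * (N - k)) / fact (2 * (N - k))))" for N

  have summable_cosh: "summable (\<lambda>n. norm (y ^ (2 * n) / fact (2 * n)))" for y :: real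
    using sums_summable[OF cosh_sums_even[of "\<bar>y\<bar>"]] by (simp add: power_abs)

  have "(\<Sum>N. f N t) = (1 - t\<^sup>2) powr (\<nu> + 1/2) * cosh (x * t) * (\<Sum>n. hyp_coeff \<nu> n * z t ^ n)" for t
  proof -
    have "(\<lambda>N. \<Sum>k\<le>N. g t k * h t (N - k)) sums ((\<Sum>k. g t k) * (\<Sum>k. h t k))"
      unfolding g_def h_def
      by (intro Cauchy_product_sums summable_hyp_coeff assms summable_cosh)
    moreover have "(\<Sum>k. h t k) = cosh (x * t)"
      unfolding h_def by (rule sums_unique[symmetric, OF cosh_sums_even])
    ultimately have "(\<lambda>N. f N t) sums ((1 - t\<^sup>2) powr (\<nu> + 1/2) * ((\<Sum>k. g t k) * cosh (x * t)))"
      unfolding f_def by (intro sums_mult) simp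
    then show ?thesis by (simp add: sums_iff g_def mult_ac)
  qed
  moreover have "(\<lambda>N. integral {0..1} (f N)) sums integral {0..1} (\<lambda>t. \<Sum>N. f N t)"
  proof (rule integral_series_uniform)
    \<comment> \<open>At \<open>t = 1\<close> the base of the weight vanishes; continuity there
      rests on \<open>\<nu> + 1/2 > 0\<close>.\<close>
    show "continuous_on {0..1} (f N)" for N
      unfolding f_def g_def h_def z_def using assms
      by (intro continuous_intros continuous_on_powr') (auto simp: power_le_one)
    show "summable M"
      unfolding M_def
      using summable_hyp_coeff[OF assms(1), of "x\<^sup>2 / 16"] summable_cosh[of x]
      by (intro summable_Cauchy_product) (simp_all only: real_norm_def abs_abs)
    fix N and t :: real
    assume "t \<in> {0..1}"
    then have t: "0 \<le> t" "t \<le> 1" by auto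
    then have s: "0 \<le> 1 - t\<^sup>2" "1 - t\<^sup>2 \<le> 1" by (auto simp: power_le_one)
    have "\<bar>f N t\<bar> \<le> 1 * \<bar>\<Sum>k\<le>N. g t k * h t (N - k)\<bar>"
      unfolding f_def abs_mult using s assms by (intro mult_right_mono) (auto intro!: powr_le1)
    also have "\<dots> \<le> (\<Sum>k\<le>N. \<bar>g t k * h t (N - k)\<bar>)"
      by simp
    also have "\<dots> \<le> M N"
      unfolding M_def abs_mult
    proof (intro sum_mono mult_mono)
      fix k
      have "\<bar>z t\<bar> \<le> x\<^sup>2 / 16"
        using s mult_left_le[of "(1 - t\<^sup>2)\<^sup>2" "x\<^sup>2 / 16"] by (simp add: z_def abs_mult power_le_one)
      then show "\<bar>g t k\<bar> \<le> norm (hyp_coeff \<nu> k * (x\<^sup>2 / 16) ^ k)"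
        unfolding g_def by (simp add: abs_mult power_abs mult_left_mono power_mono)
      have "(x * t) ^ n \<le> x ^ n" for n
        using t assms by (intro power_mono) (auto intro: mult_left_le)
      then show "\<bar>h t (N - k)\<bar> \<le> norm (x ^ (2 * (N - k)) / fact (2 * (N - k)))"
        unfolding h_def using t assms by (simp add: divide_right_mono)
    qed auto
    finally show "\<bar>f N t\<bar> \<le> M N" .
  qed
  moreover have "C * integral {0..1} (f N) =
    x ^ (2 * N) * ((1/2) powr (2 * real N + \<nu> + 1) / (Gamma (real N + 3/2) * Gamma (real N + \<nu> + 3/2)))" for N
  proof -
    define T where "T k = hyp_coeff \<nu> k * (- 1/16) ^ k / fact (2 * (N - k))" for k
    define B where "B k = Beta (real (N - k) + 1/2) (\<nu> + 1/2 + real (2 * k) + 1) / 2" for k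
    \<comment> \<open>The \<open>k\<close>-th power of the hypergeometric argument raises the
      exponent of the weight by \<open>2 * k\<close>, so every summand is again a Beta
      integral.\<close>
    have "((\<lambda>t. \<Sum>k\<le>N. x ^ (2 * N) * T k * ((1 - t\<^sup>2) powr (\<nu> + 1/2 + real (2 * k)) * t ^ (2 * (N - k))))
      has_integral (\<Sum>k\<le>N. x ^ (2 * N) * T k * B k)) {0..1}"
      unfolding B_def using assms
      by (intro has_integral_sum has_integral_mult_right has_integral_one_minus_square_powr_even_power) auto
    also have "?this \<longleftrightarrow> (f N has_integral (\<Sum>k\<le>N. x ^ (2 * N) * T k * B k)) {0..1}"
    proof (rule has_integral_cong)
      fix t :: real assume "t \<in> {0..1}"
      then have s: "0 \<le> 1 - t\<^sup>2" by (auto simp: power_le_one)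
      have "x ^ (2 * N) * T k * ((1 - t\<^sup>2) powr (\<nu> + 1/2 + real (2 * k)) * t ^ (2 * (N - k))) =
        (1 - t\<^sup>2) powr (\<nu> + 1/2) * (g t k * h t (N - k))" if "k \<le> N" for k
      proof -
        have "x ^ (2 * N) = (x\<^sup>2) ^ k * x ^ (2 * (N - k))"
          using that by (simp flip: power_mult power_add add: distrib_left[symmetric])
        moreover have "(- (x\<^sup>2 / 16)) ^ k = (- 1/16) ^ k * (x\<^sup>2) ^ k"
          by (simp flip: power_mult_distrib)
        moreover have "(1 - t\<^sup>2) powr (\<nu> + 1/2 + real (2 * k)) = (1 - t\<^sup>2) powr (\<nu> + 1/2) * ((1 - t\<^sup>2)\<^sup>2) ^ k"
          using powr_mult_power[OF s, of "\<nu> + 1/2" "2 * k"] by (simp add: power_mult)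
        ultimately show ?thesis
          unfolding T_def g_def h_def z_def power_mult_distrib[of "- (x\<^sup>2 / 16)"] power_mult_distrib[of x]
          by simp
      qed
      then show "(\<Sum>k\<le>N. x ^ (2 * N) * T k * ((1 - t\<^sup>2) powr (\<nu> + 1/2 + real (2 * k)) * t ^ (2 * (N - k)))) = f N t"
        unfolding f_def sum_distrib_left by (intro sum.cong) auto
    qed
    finally have "C * integral {0..1} (f N) = x ^ (2 * N) * (C * (\<Sum>k\<le>N. T k * B k))"
      by (simp add: integral_unique sum_distrib_left mult_ac)
    then show ?thesis
      unfolding T_def B_def C_def struve_L_coefficient[OF assms(1)] .
  qed
  then have "x powr (\<nu> + 1) * (C * integral {0..1} (f N)) =
     (x / 2) powr (2 * real N + \<nu> + 1) / (Gamma (real N + 3/2) * Gamma (real N + \<nu> + 3/2))" for N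
  proof -
    have "x powr (\<nu> + 1) * x ^ (2 * N) = x powr (2 * real N + \<nu> + 1)"
      using powr_mult_power[of x "\<nu> + 1" "2 * N"] assms by (simp add: add_ac)
    moreover have "(x / 2) powr p = x powr p * (1/2) powr p" for p
      using powr_mult[of x "1/2" p] assms by simp
    ultimately show ?thesis
      using \<open>C * integral {0..1} (f N) = _\<close> by (simp flip: mult.assoc)
  qed
  ultimately have "(\<lambda>N. (x / 2) powr (2 * real N + \<nu> + 1) / (Gamma (real N + 3/2) * Gamma (real N + \<nu> + 3/2)))
    sums (x powr (\<nu> + 1) * (C * integral {0..1} (\<lambda>t. (1 - t\<^sup>2) powr (\<nu> + 1/2) * cosh (x * t) *
       (\<Sum>n. hyp_coeff \<nu> n * z t ^ n))))"
    using sums_mult[of "\<lambda>N. integral {0..1} (f N)" _ "x powr (\<nu> + 1) * C"] by (simp add: mult.assoc)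
  then show ?thesis
    unfolding struve_L_def hypergeo_pFq_eq_hyp_coeff
    by (simp add: sums_iff C_def z_def)
qed

end
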